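(* Let $C$ be a nonempty closed convex subset of $\mathbb{R}^m$ and let $f:C\times C\to\mathbb{R}$ be a bifunction with $f(x,x)=0$ for all $x\in C$ such that: (i) $f$ is strongly pseudomonotone on $C$: there exists $\gamma>0$ such that for all $x,y\in C$, $f(x,y)\ge 0$ implies $f(y,x)\le-\gamma\|x-y\|^2$; (ii) $f$ satisfies a Lipschitz-type condition on $C$: there exist $c_1>0$, $c_2>0$ such that $f(x,y)+f(y,z)\ge f(x,z)-c_1\|x-y\|^2-c_2\|y-z\|^2$ for all $x,y,z\in C$; (iii) for each $x\in C$, the function $f(x,\cdot)$ is convex and lower semicontinuous on $C$, and for each $y\in C$, the function $f(\cdot,y)$ is hemicontinuous on $C$. Let $x^\dagger$ be the unique solution of the equilibrium problem, i.e. the unique point $x^\dagger\in C$ with $f(x^\dagger,y)\ge 0$ for all $y\in C$. Let $\varphi=\frac12(\sqrt5+1)$, $\mu\in(0,\frac12\varphi)$, $\lambda_0>0$, $\bar x_{-1}\in\mathbb{R}^m$ and $x_{-1},x_0\in C$ be arbitrary, and let $\{x_n\}$ be the sequence generated by the Explicit Golden Ratio Algorithm (described in the context) from these data. Then $\{x_n\}$ converges at least $R$-linearly to $x^\dagger$; that is, $x_n\to x^\dagger$ and $$\limsup_{n\to\infty}\|x_n-x^\dagger\|^{1/n}<1.$$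
   Context: For a proper, lower semicontinuous, convex function $g:C\to\mathbb{R}$ and $\lambda>0$, the proximal operator is $$\mathrm{prox}_{\lambda g}(z)=\arg\min\left\{\lambda g(x)+\tfrac12\|x-z\|^2 : x\in C\right\},\quad z\in\mathbb{R}^m.$$ Write $[t]_+=\max\{0,t\}$. Explicit Golden Ratio Algorithm (EGRA). Given $\bar x_{-1}\in\mathbb{R}^m$, $x_{-1},x_0\in C$, $\lambda_0>0$ and $\mu\in(0,\frac12\varphi)$ with $\varphi=\frac12(\sqrt5+1)$, define for $n=0,1,2,\dots$ $$\bar x_n=\frac{(\varphi-1)x_n+\bar x_{n-1}}{\varphi},\qquad x_{n+1}=\mathrm{prox}_{\lambda_n f(x_n,\cdot)}(\bar x_n),$$ $$\lambda_{n+1}=\min\left\{\lambda_n,\ \frac{\mu\left(\|x_{n-1}-x_n\|^2+\|x_n-x_{n+1}\|^2\right)}{2\left[f(x_{n-1},x_{n+1})-f(x_{n-1},x_n)-f(x_n,x_{n+1})\right]_+}\right\}.$$ Whenever the denominator is zero, the fraction is interpreted as $+\infty$ (including the case $\frac00=+\infty$), so that $\lambda_{n+1}=\lambda_n$ in that case. A function $h:C\to\mathbb{R}$ is hemicontinuous on $C$ if it is continuous along line segments, i.e. for all $x,z\in C$ the function $t\mapsto h(tz+(1-t)x)$ is continuous on $[0,1]$. Under hypotheses (i)-(iii) and $f(x,x)=0$ it is known that the equilibrium problem has exactly one solution $x^\dagger$. *)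

theory Defs
  imports "HOL-Analysis.Analysis"
begin

text \<open>
  Bifunctions on \<open>C \<times> C\<close> are total functions \<open>'a \<Rightarrow> 'a \<Rightarrow> real\<close>; every condition below
  constrains them only at points of \<open>C\<close>.
\<close>

definition lower_semicontinuous_on :: "'a::topological_space set \<Rightarrow> ('a \<Rightarrow> real) \<Rightarrow> bool" where
  "lower_semicontinuous_on C g \<longleftrightarrow>
     (\<forall>x\<in>C. \<forall>a < g x. \<forall>\<^sub>F y in at x within C. a < g y)"

definition hemicontinuous_on :: "'a::real_normed_vector set \<Rightarrow> ('a \<Rightarrow> real) \<Rightarrow> bool" where
  "hemicontinuous_on C h \<longleftrightarrow>
     (\<forall>x\<in>C. \<forall>z\<in>C. continuous_on {0..1} (\<lambda>t. h (t *\<^sub>R z + (1 - t) *\<^sub>R x)))"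

definition strongly_pseudomonotone_on ::
    "'a::real_normed_vector set \<Rightarrow> ('a \<Rightarrow> 'a \<Rightarrow> real) \<Rightarrow> bool" where
  "strongly_pseudomonotone_on C f \<longleftrightarrow>
     (\<exists>\<gamma>>0. \<forall>x\<in>C. \<forall>y\<in>C. f x y \<ge> 0 \<longrightarrow> f y x \<le> - \<gamma> * (norm (x - y))\<^sup>2)"

definition lipschitz_type_on ::
    "'a::real_normed_vector set \<Rightarrow> ('a \<Rightarrow> 'a \<Rightarrow> real) \<Rightarrow> bool" where
  "lipschitz_type_on C f \<longleftrightarrow>
     (\<exists>c1>0. \<exists>c2>0. \<forall>x\<in>C. \<forall>y\<in>C. \<forall>z\<in>C.
        f x y + f y z \<ge> f x z - c1 * (norm (x - y))\<^sup>2 - c2 * (norm (y - z))\<^sup>2)"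

definition equilibrium_solution :: "'a set \<Rightarrow> ('a \<Rightarrow> 'a \<Rightarrow> real) \<Rightarrow> 'a \<Rightarrow> bool" where
  "equilibrium_solution C f x \<longleftrightarrow> x \<in> C \<and> (\<forall>y\<in>C. f x y \<ge> 0)"

lemma equilibrium_solution_unique:
  assumes "strongly_pseudomonotone_on C f"
    and x: "equilibrium_solution C f x" and y: "equilibrium_solution C f y"
  shows "x = y"
proof -
  obtain \<gamma> where "\<gamma> > 0" and
    \<gamma>: "\<And>x y. x \<in> C \<Longrightarrow> y \<in> C \<Longrightarrow> f x y \<ge> 0 \<Longrightarrow> f y x \<le> - \<gamma> * (norm (x - y))\<^sup>2"
    using assms(1) unfolding strongly_pseudomonotone_on_def by blast
  have "0 \<le> f y x"
    using x y by (simp add: equilibrium_solution_def)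
  also have "f y x \<le> - \<gamma> * (norm (x - y))\<^sup>2"
    using x y by (intro \<gamma>) (auto simp: equilibrium_solution_def)
  finally have "\<gamma> * (norm (x - y))\<^sup>2 \<le> 0"
    by simp
  with \<open>\<gamma> > 0\<close> show ?thesis
    by (simp add: mult_le_0_iff)
qed

text \<open>
  For \<open>C\<close> nonempty, closed and convex in a Euclidean space, \<open>g\<close> convex and lower semicontinuous
  on \<open>C\<close> and \<open>lam > 0\<close>, the objective has exactly one minimiser on \<open>C\<close>, so the
  choice operator underlying \<open>arg_min_on\<close> has no freedom.
\<close>

definition prox :: "'a::real_normed_vector set \<Rightarrow> real \<Rightarrow> ('a \<Rightarrow> real) \<Rightarrow> 'a \<Rightarrow> 'a" where
  "prox C lam g z = arg_min_on (\<lambda>x. lam * g x + (norm (x - z))\<^sup>2 / 2) C"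

definition golden_ratio :: real where
  "golden_ratio = (sqrt 5 + 1) / 2"

text \<open>
  The iteration starts at index \<open>-1\<close>, so the sequences are indexed by \<open>int\<close>; their values
  at other negative indices (and \<open>lam\<close> at all negative ones) are irrelevant. The conditional in
  the step size rule implements the convention that a fraction with zero denominator is
  \<open>+\<infinity>\<close>.
\<close>

definition egra_step_size ::
    "('a::real_normed_vector \<Rightarrow> 'a \<Rightarrow> real) \<Rightarrow> real \<Rightarrow> real \<Rightarrow> 'a \<Rightarrow> 'a \<Rightarrow> 'a \<Rightarrow> real" where
  "egra_step_size f \<mu> lam u v w =
     (let d = 2 * max 0 (f u w - f u v - f v w) in
      if d = 0 then lam
      else min lam (\<mu> * ((norm (u - v))\<^sup>2 + (norm (v - w))\<^sup>2) / d))"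

definition egra ::
    "'a::real_normed_vector set \<Rightarrow> ('a \<Rightarrow> 'a \<Rightarrow> real) \<Rightarrow> real \<Rightarrow>
     (int \<Rightarrow> 'a) \<Rightarrow> (int \<Rightarrow> 'a) \<Rightarrow> (int \<Rightarrow> real) \<Rightarrow> bool" where
  "egra C f \<mu> xbar x lam \<longleftrightarrow>
     (\<forall>n\<ge>0.
        xbar n = ((golden_ratio - 1) *\<^sub>R x n + xbar (n - 1)) /\<^sub>R golden_ratio \<and>
        x (n + 1) = prox C (lam n) (f (x n)) (xbar n) \<and>
        lam (n + 1) = egra_step_size f \<mu> (lam n) (x (n - 1)) (x n) (x (n + 1)))"

end

theory Submission
  imports Defs
begin

text \<open>
  Write \<open>a\<^sub>n = \<parallel>xbar\<^sub>n - xdag\<parallel>\<^sup>2\<close>, \<open>d\<^sub>n = \<parallel>x\<^sub>n - x\<^sub>n\<^sub>-\<^sub>1\<parallel>\<^sup>2\<close>, \<open>e\<^sub>n = \<parallel>x\<^sub>n - xdag\<parallel>\<^sup>2\<close> and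
  \<open>g\<^sub>n = \<parallel>xbar\<^sub>n - x\<^sub>n\<parallel>\<^sup>2\<close>. The optimality conditions of two consecutive proximal steps
  (\<open>prox_variational_inequality\<close>), the step size rule and strong pseudomonotonicity combine to
  (\<open>egra_energy_inequality\<close>)
  \<open>\<phi>\<^sup>2 a\<^sub>n\<^sub>+\<^sub>1 + (\<phi> \<theta>\<^sub>n - \<kappa>\<^sub>n \<mu>) d\<^sub>n\<^sub>+\<^sub>1 + 2 lam\<^sub>n \<gamma> e\<^sub>n + \<phi> \<theta>\<^sub>n g\<^sub>n \<le> \<phi>\<^sup>2 a\<^sub>n + \<kappa>\<^sub>n \<mu> d\<^sub>n\<close>,
  where \<open>\<theta>\<^sub>n = lam\<^sub>n / lam\<^sub>n\<^sub>-\<^sub>1\<close> and \<open>\<kappa>\<^sub>n = lam\<^sub>n / lam\<^sub>n\<^sub>+\<^sub>1\<close>.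

  The step sizes decrease, and the Lipschitz-type condition keeps them away from \<open>0\<close>
  (\<open>egra_invariant\<close>), so both ratios tend to \<open>1\<close> and the coefficients of \<open>d\<close> tend to \<open>\<phi> - \<mu>\<close> on
  the left and \<open>\<mu>\<close> on the right. As \<open>\<mu> < \<phi> / 2\<close>, the left one is eventually larger by a fixed
  factor. The terms in \<open>e\<^sub>n\<close> and \<open>g\<^sub>n\<close>, whose coefficients stay above a positive constant,
  together dominate a multiple of \<open>a\<^sub>n\<close>. Hence
  \<open>\<phi>\<^sup>2 a\<^sub>n + A d\<^sub>n\<close>, for a suitable constant \<open>A\<close>, eventually contracts by a factor below \<open>1\<close> in each
  step (\<open>energy_recursion_imp_geometric\<close>) and bounds a multiple of \<open>e\<^sub>n\<close>, which gives the rate.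
\<close>

section \<open>Existence of proximal points\<close>

lemma lower_semicontinuous_on_subset:
  assumes "lower_semicontinuous_on C g" "S \<subseteq> C"
  shows "lower_semicontinuous_on S g"
  using assms(1) filter_leD[OF at_le[OF assms(2)]] assms(2)
  unfolding lower_semicontinuous_on_def by blast

text \<open>
  If no point were minimal, the superlevel sets \<open>{x. g y < g x}\<close> with \<open>y \<in> S\<close> would cover \<open>S\<close>.
  They are relatively open, so finitely many suffice; the point \<open>y\<close> of this finite family with the
  smallest value then lies in none of them.
\<close>
lemma lower_semicontinuous_attains_inf:
  fixes g :: "'a::topological_space \<Rightarrow> real"
  assumes "compact S" "S \<noteq> {}" and lsc: "lower_semicontinuous_on S g"
  shows "\<exists>x\<in>S. \<forall>y\<in>S. g x \<le> g y"
proof (rule ccontr)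
  assume "\<not> ?thesis"
  then have "\<forall>x\<in>S. \<exists>y\<in>S. g y < g x"
    by (meson not_le)
  then obtain s where s: "\<And>x. x \<in> S \<Longrightarrow> s x \<in> S \<and> g (s x) < g x"
    by metis
  have "\<exists>T. open T \<and> x \<in> T \<and> (\<forall>y\<in>T \<inter> S. g (s x) < g y)" if "x \<in> S" for x
  proof -
    have "\<forall>\<^sub>F y in at x within S. g (s x) < g y"
      using lsc s[OF that] that unfolding lower_semicontinuous_on_def by blast
    then show ?thesis
      using s[OF that] unfolding eventually_at_topological by (metis IntE)
  qed
  then obtain T where T: "\<And>x. x \<in> S \<Longrightarrow> open (T x) \<and> x \<in> T x \<and> (\<forall>y\<in>T x \<inter> S. g (s x) < g y)"
    by metis
  obtain F where F: "F \<subseteq> S" "finite F" "S \<subseteq> (\<Union>x\<in>F. T x)"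
    using compactE_image[OF \<open>compact S\<close>, of S T] T by blast
  have "F \<noteq> {}"
    using F \<open>S \<noteq> {}\<close> by auto
  define z where "z = arg_min_on (g \<circ> s) F"
  have z: "z \<in> F" "\<And>y. y \<in> F \<Longrightarrow> g (s z) \<le> g (s y)"
    using arg_min_if_finite[OF F(2) \<open>F \<noteq> {}\<close>, of "g \<circ> s"]
    by (auto simp: z_def not_less)
  then have "s z \<in> S"
    using F s by blast
  then obtain y where "y \<in> F" "s z \<in> T y"
    using F by blast
  then have "g (s y) < g (s z)"
    using T F \<open>s z \<in> S\<close> by blast
  then show False
    using z(2)[OF \<open>y \<in> F\<close>] by simp
qed

text \<open>
  By compactness \<open>g\<close> is bounded below on the unit ball around \<open>a\<close>, and a point farther away is shrunk
  into that ball by convexity. The purpose of the linear lower bound is that the quadratic term of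
  the proximal objective dominates it.
\<close>
lemma convex_on_linear_minorant:
  fixes C :: "'a::euclidean_space set"
  assumes "closed C" and conv: "convex_on C g" and "lower_semicontinuous_on C g" and "a \<in> C"
  obtains K where "0 \<le> K" "\<And>x. x \<in> C \<Longrightarrow> 1 \<le> norm (x - a) \<Longrightarrow> g a - K * norm (x - a) \<le> g x"
proof -
  let ?B = "C \<inter> cball a 1"
  have "a \<in> ?B" "compact ?B" "lower_semicontinuous_on ?B g"
    using assms lower_semicontinuous_on_subset[of C g ?B]
    by (simp_all add: closed_Int_compact)
  then obtain b where b: "b \<in> ?B" "\<And>y. y \<in> ?B \<Longrightarrow> g b \<le> g y"
    using lower_semicontinuous_attains_inf[of ?B g] by blast
  show thesis
  proof (rule that[of "g a - g b"])
    show "0 \<le> g a - g b"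
      using b(2)[of a] \<open>a \<in> C\<close> by simp
    fix x assume x: "x \<in> C" "1 \<le> norm (x - a)"
    define t where "t = 1 / norm (x - a)"
    have t: "0 < t" "t \<le> 1" "t * norm (x - a) = 1"
      using x(2) by (auto simp: t_def divide_simps)
    define y where "y = (1 - t) *\<^sub>R a + t *\<^sub>R x"
    have "y - a = t *\<^sub>R (x - a)"
      by (simp add: y_def algebra_simps)
    then have "norm (y - a) = 1"
      using t by simp
    moreover have "y \<in> C"
      unfolding y_def using convexD_alt[OF convex_on_imp_convex[OF conv] \<open>a \<in> C\<close> x(1)] t by simp
    ultimately have "g b \<le> g y"
      using b(2) by (simp add: dist_norm norm_minus_commute)
    also have "g y \<le> (1 - t) * g a + t * g x"
      unfolding y_def using convex_onD[OF conv, of t a x] t x(1) \<open>a \<in> C\<close> by simp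
    finally have "norm (x - a) * g b \<le> norm (x - a) * ((1 - t) * g a + t * g x)"
      by (intro mult_left_mono) auto
    also have "\<dots> = (norm (x - a) - t * norm (x - a)) * g a + (t * norm (x - a)) * g x"
      by (simp add: algebra_simps)
    finally show "g a - (g a - g b) * norm (x - a) \<le> g x"
      using t(3) by (simp add: algebra_simps)
  qed
qed

lemma lower_semicontinuous_on_prox_objective:
  fixes g :: "'a::real_normed_vector \<Rightarrow> real"
  assumes "lower_semicontinuous_on C g" "0 < l"
  shows "lower_semicontinuous_on C (\<lambda>x. l * g x + (norm (x - z))\<^sup>2 / 2)"
  unfolding lower_semicontinuous_on_def
proof (intro ballI allI impI)
  fix x r assume x: "x \<in> C" and r: "r < l * g x + (norm (x - z))\<^sup>2 / 2"
  define e where "e = (l * g x + (norm (x - z))\<^sup>2 / 2 - r) / 2"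
  have "0 < e"
    using r by (simp add: e_def)
  have "((\<lambda>y. (norm (y - z))\<^sup>2 / 2) \<longlongrightarrow> (norm (x - z))\<^sup>2 / 2) (at x within C)"
    by (intro tendsto_intros) auto
  then have 1: "\<forall>\<^sub>F y in at x within C. (norm (x - z))\<^sup>2 / 2 - e < (norm (y - z))\<^sup>2 / 2"
    by (rule order_tendstoD) (use \<open>0 < e\<close> in auto)
  have "g x - e / l < g x"
    using \<open>0 < e\<close> \<open>0 < l\<close> by simp
  then have 2: "\<forall>\<^sub>F y in at x within C. g x - e / l < g y"
    using assms x unfolding lower_semicontinuous_on_def by blast
  show "\<forall>\<^sub>F y in at x within C. r < l * g y + (norm (y - z))\<^sup>2 / 2"
    using 1 2
  proof eventually_elim
    case (elim y)
    then have "l * (g x - e / l) < l * g y"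
      using \<open>0 < l\<close> by (intro mult_strict_left_mono) auto
    then have "l * g x - e < l * g y"
      using \<open>0 < l\<close> by (simp add: algebra_simps)
    then show ?case
      using elim(1) by (simp add: e_def field_simps)
  qed
qed

text \<open>
  By \<open>convex_on_linear_minorant\<close> the proximal objective exceeds its value at a fixed point of \<open>C\<close>
  outside a large ball, so a minimiser over the compact part of \<open>C\<close> inside the ball is global.
\<close>
lemma prox_is_minimizer:
  fixes C :: "'a::euclidean_space set"
  assumes "C \<noteq> {}" "closed C" "convex_on C g" "lower_semicontinuous_on C g" "0 < l"
  shows prox_in: "prox C l g z \<in> C"
    and prox_le: "y \<in> C \<Longrightarrow> l * g (prox C l g z) + (norm (prox C l g z - z))\<^sup>2 / 2
                            \<le> l * g y + (norm (y - z))\<^sup>2 / 2"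
proof -
  let ?h = "\<lambda>x. l * g x + (norm (x - z))\<^sup>2 / 2"
  obtain a where "a \<in> C"
    using assms(1) by blast
  obtain K where K: "0 \<le> K"
    "\<And>x. x \<in> C \<Longrightarrow> 1 \<le> norm (x - a) \<Longrightarrow> g a - K * norm (x - a) \<le> g x"
    using convex_on_linear_minorant[OF assms(2-4) \<open>a \<in> C\<close>] by blast
  define M where "M = l * K + norm (a - z)"
  have M: "norm (a - z) \<le> M" "0 \<le> M"
    using K(1) \<open>0 < l\<close> by (simp_all add: M_def)
  define R where "R = 1 + 2 * M"
  have "1 \<le> R"
    using M by (simp add: R_def)
  let ?B = "C \<inter> cball a R"
  have "a \<in> ?B" "compact ?B" "lower_semicontinuous_on ?B ?h"
    using assms \<open>a \<in> C\<close> \<open>1 \<le> R\<close>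
      lower_semicontinuous_on_subset[OF lower_semicontinuous_on_prox_objective, of C g l ?B z]
    by (simp_all add: closed_Int_compact)
  then obtain p where p: "p \<in> ?B" "\<And>y. y \<in> ?B \<Longrightarrow> ?h p \<le> ?h y"
    using lower_semicontinuous_attains_inf[of ?B ?h] by blast
  have "?h p \<le> ?h y" if "y \<in> C" for y
  proof (cases "y \<in> cball a R")
    case True
    then show ?thesis
      using p(2) that by blast
  next
    case False
    define r where "r = norm (y - a)"
    have r: "R < r"
      using False by (simp add: r_def dist_norm norm_minus_commute)
    then have "l * (g a - K * r) \<le> l * g y"
      using K(2)[OF that] \<open>1 \<le> R\<close> \<open>0 < l\<close> by (simp add: r_def)
    moreover have "(r - norm (a - z))\<^sup>2 \<le> (norm (y - z))\<^sup>2"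
    proof (rule power_mono)
      show "r - norm (a - z) \<le> norm (y - z)"
        unfolding r_def using norm_triangle_ineq4[of "y - z" "a - z"] by simp
      show "0 \<le> r - norm (a - z)"
        using r norm_ge_zero[of "a - z"] M by (simp add: R_def)
    qed
    moreover have "0 \<le> r * (r - 2 * M)"
      using r \<open>1 \<le> R\<close> by (intro mult_nonneg_nonneg) (auto simp: R_def)
    ultimately have "?h a \<le> ?h y"
      by (simp add: M_def power2_eq_square algebra_simps)
    then show ?thesis
      using p(2)[of a] \<open>a \<in> C\<close> \<open>1 \<le> R\<close> by auto
  qed
  then have "is_arg_min ?h (\<lambda>x. x \<in> C) p"
    using p(1) by (auto simp: is_arg_min_def not_less)
  then have m: "is_arg_min ?h (\<lambda>x. x \<in> C) (prox C l g z)"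
    unfolding prox_def arg_min_on_def arg_min_def by (rule someI)
  then show "prox C l g z \<in> C"
    by (simp add: is_arg_min_def)
  show "y \<in> C \<Longrightarrow> ?h (prox C l g z) \<le> ?h y"
    using m by (auto simp: is_arg_min_def not_less)
qed

text \<open>
  First-order optimality: compare the minimiser \<open>p\<close> with \<open>p + t (y - p)\<close>, divide by \<open>t\<close>
  and let \<open>t\<close> tend to \<open>0\<close>.
\<close>
lemma prox_variational_inequality:
  fixes C :: "'a::euclidean_space set"
  assumes "C \<noteq> {}" "closed C" and conv: "convex_on C g" and "lower_semicontinuous_on C g" "0 < l"
    and p: "p = prox C l g z" and "y \<in> C"
  shows "inner (z - p) (y - p) \<le> l * (g y - g p)"
proof -
  have "p \<in> C"
    using prox_in[OF assms(1-5)] p by simp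
  have *: "inner (z - p) (y - p) \<le> l * (g y - g p) + t * ((norm (y - p))\<^sup>2 / 2)"
    if t: "0 < t" "t \<le> 1" for t
  proof -
    define w where "w = (1 - t) *\<^sub>R p + t *\<^sub>R y"
    have "w \<in> C"
      unfolding w_def using convexD_alt[OF convex_on_imp_convex[OF conv] \<open>p \<in> C\<close> \<open>y \<in> C\<close>] t by simp
    then have "l * g p + (norm (p - z))\<^sup>2 / 2 \<le> l * g w + (norm (w - z))\<^sup>2 / 2"
      using prox_le[OF assms(1-5)] p by simp
    also have "l * g w \<le> l * ((1 - t) * g p + t * g y)"
      unfolding w_def using convex_onD[OF conv, of t p y] t \<open>p \<in> C\<close> \<open>y \<in> C\<close> \<open>0 < l\<close> by simp
    finally have 1: "l * g p + (norm (p - z))\<^sup>2 / 2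
        \<le> l * ((1 - t) * g p + t * g y) + (norm (w - z))\<^sup>2 / 2"
      by simp
    have wz: "w - z = (p - z) + t *\<^sub>R (y - p)"
      by (simp add: w_def algebra_simps)
    have "(norm (w - z))\<^sup>2
        = (norm (p - z))\<^sup>2 + 2 * t * inner (p - z) (y - p) + t\<^sup>2 * (norm (y - p))\<^sup>2"
      unfolding wz power2_norm_eq_inner inner_add_left inner_add_right inner_scaleR_left
        inner_scaleR_right inner_commute[of "y - p" "p - z"]
      by (simp add: power2_eq_square distrib_left)
    moreover have "inner (p - z) (y - p) = - inner (z - p) (y - p)"
      by (metis inner_minus_left minus_diff_eq)
    ultimately have "t * inner (z - p) (y - p)
        \<le> t * (l * (g y - g p) + t * ((norm (y - p))\<^sup>2 / 2))"
      using 1 by (simp add: power2_eq_square algebra_simps)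
    then show ?thesis
      using t by simp
  qed
  have "((\<lambda>t. l * (g y - g p) + t * ((norm (y - p))\<^sup>2 / 2))
      \<longlongrightarrow> l * (g y - g p) + 0 * ((norm (y - p))\<^sup>2 / 2)) (at_right 0)"
    by (intro tendsto_intros)
  moreover have "\<forall>\<^sub>F t in at_right 0. inner (z - p) (y - p)
      \<le> l * (g y - g p) + t * ((norm (y - p))\<^sup>2 / 2)"
    by (rule eventually_at_rightI[of 0 1]) (use * in auto)
  ultimately have "inner (z - p) (y - p) \<le> l * (g y - g p) + 0 * ((norm (y - p))\<^sup>2 / 2)"
    by (rule tendsto_lowerbound) simp
  then show ?thesis
    by simp
qed

section \<open>The energy inequality\<close>

lemma golden_ratio_gt_1: "1 < golden_ratio"
  by (simp add: golden_ratio_def)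

lemma golden_ratio_square: "golden_ratio * golden_ratio = golden_ratio + 1"
  by (simp add: golden_ratio_def field_simps)

text \<open>
  \<open>w\<close> is the affine combination \<open>\<phi>\<^sup>2 b' - \<phi> b\<close>, because \<open>\<phi> / (\<phi> - 1) = \<phi>\<^sup>2\<close>. This identity trades the
  distance of the new iterate \<open>w\<close> to the solution for distances of the averages \<open>b\<close> and \<open>b'\<close>.
\<close>
lemma golden_average_norm:
  fixes w b b' s :: "'a::real_inner"
  assumes "b' = ((golden_ratio - 1) *\<^sub>R w + b) /\<^sub>R golden_ratio"
  shows "golden_ratio\<^sup>2 * (norm (b' - s))\<^sup>2
    = (norm (w - s))\<^sup>2 + golden_ratio * (norm (b - s))\<^sup>2 - (golden_ratio - 1) * (norm (w - b))\<^sup>2"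
proof -
  let ?\<phi> = "golden_ratio"
  define u v where "u = w - s" and "v = b - s"
  have "?\<phi> *\<^sub>R (b' - s) = (?\<phi> - 1) *\<^sub>R u + v"
    using golden_ratio_gt_1 by (simp add: assms u_def v_def algebra_simps)
  then have "?\<phi>\<^sup>2 * (norm (b' - s))\<^sup>2 = (norm ((?\<phi> - 1) *\<^sub>R u + v))\<^sup>2"
    by (metis norm_scaleR power2_abs power_mult_distrib)
  also have "\<dots> = (?\<phi> - 1) * (?\<phi> - 1) * inner u u + 2 * (?\<phi> - 1) * inner u v + inner v v"
    by (simp add: power2_norm_eq_inner inner_add_left inner_add_right inner_commute[of v u])
      (simp add: algebra_simps)
  also have "(?\<phi> - 1) * (?\<phi> - 1) = 2 - ?\<phi>"
    using golden_ratio_square by (simp add: algebra_simps)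
  also have "(2 - ?\<phi>) * inner u u + 2 * (?\<phi> - 1) * inner u v + inner v v
      = inner u u + ?\<phi> * inner v v - (?\<phi> - 1) * (inner u u - 2 * inner u v + inner v v)"
    by (simp add: algebra_simps)
  also have "inner u u - 2 * inner u v + inner v v = inner (u - v) (u - v)"
    by (simp add: inner_diff_left inner_diff_right inner_commute[of v u])
  finally show ?thesis
    by (simp add: power2_norm_eq_inner u_def v_def)
qed

lemma inner_diff_polarization:
  fixes a b c :: "'a::real_inner"
  shows "2 * inner (a - b) (c - b) = (norm (a - b))\<^sup>2 + (norm (c - b))\<^sup>2 - (norm (a - c))\<^sup>2"
  by (simp add: power2_norm_eq_inner inner_diff_left inner_diff_right inner_commute)

text \<open>
  Here \<open>u\<close>, \<open>v\<close>, \<open>w\<close> are three consecutive iterates and \<open>b''\<close>, \<open>b\<close>, \<open>b'\<close> the corresponding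
  averages. The optimality of \<open>w\<close> is tested at \<open>s\<close>, and that of \<open>v\<close> at \<open>w\<close>; since
  \<open>b'' - v = \<phi> (b - v)\<close>, rescaling the second inequality by \<open>l / l'\<close> lets the two be added. The
  values of \<open>f\<close> then appear as \<open>f v s\<close> and as the expression bounded by the step size rule. After
  expansion into squared norms, the coefficient of \<open>\<parallel>w - b\<parallel>\<^sup>2\<close> is \<open>\<phi> - \<phi> l / l' \<ge> 0\<close>, so this
  term can be dropped.
\<close>
lemma egra_energy_inequality:
  fixes C :: "'a::euclidean_space set"
  assumes C: "C \<noteq> {}" "closed C"
    and conv: "\<And>u. u \<in> C \<Longrightarrow> convex_on C (f u)"
    and lsc: "\<And>u. u \<in> C \<Longrightarrow> lower_semicontinuous_on C (f u)"
    and u: "u \<in> C" and v: "v \<in> C" and s: "s \<in> C"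
    and l': "0 < l'" and l: "0 < l" and "l \<le> l'"
    and vp: "v = prox C l' (f u) b''" and wp: "w = prox C l (f v) b"
    and b: "b = ((golden_ratio - 1) *\<^sub>R v + b'') /\<^sub>R golden_ratio"
    and b': "b' = ((golden_ratio - 1) *\<^sub>R w + b) /\<^sub>R golden_ratio"
    and mono: "f v s \<le> - \<gamma> * (norm (v - s))\<^sup>2"
    and step: "2 * l * (f u w - f u v - f v w)
                 \<le> \<kappa> * \<mu> * ((norm (v - u))\<^sup>2 + (norm (w - v))\<^sup>2)"
  shows "golden_ratio\<^sup>2 * (norm (b' - s))\<^sup>2
       + (golden_ratio * (l / l') - \<kappa> * \<mu>) * (norm (w - v))\<^sup>2
       + 2 * l * \<gamma> * (norm (v - s))\<^sup>2 + golden_ratio * (l / l') * (norm (b - v))\<^sup>2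
     \<le> golden_ratio\<^sup>2 * (norm (b - s))\<^sup>2 + \<kappa> * \<mu> * (norm (v - u))\<^sup>2"
proof -
  let ?\<phi> = "golden_ratio"
  define \<theta> where "\<theta> = l / l'"
  have \<theta>: "0 < \<theta>" "\<theta> \<le> 1" "\<theta> * l' = l"
    using assms by (auto simp: \<theta>_def)
  have w: "w \<in> C"
    unfolding wp using C conv lsc v l by (intro prox_in) auto
  have 1: "inner (b - w) (s - w) \<le> l * (f v s - f v w)"
    using C conv lsc v l wp s by (intro prox_variational_inequality) auto
  have "inner (b'' - v) (w - v) \<le> l' * (f u w - f u v)"
    using C conv lsc u l' vp w by (intro prox_variational_inequality) auto
  moreover have "b'' - v = ?\<phi> *\<^sub>R (b - v)"
    using golden_ratio_gt_1 by (simp add: b algebra_simps)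
  ultimately have "\<theta> * (?\<phi> * inner (b - v) (w - v)) \<le> \<theta> * (l' * (f u w - f u v))"
    using \<theta> by (intro mult_left_mono) auto
  then have 2: "\<theta> * ?\<phi> * inner (b - v) (w - v) \<le> l * (f u w - f u v)"
    by (simp add: \<theta>(3)[symmetric] mult.assoc)
  have "2 * l * f v s \<le> 2 * l * (- \<gamma> * (norm (v - s))\<^sup>2)"
    using mono l by (intro mult_left_mono) auto
  have 3: "2 * inner (b - w) (s - w) + \<theta> * ?\<phi> * (2 * inner (b - v) (w - v))
      \<le> - 2 * l * \<gamma> * (norm (v - s))\<^sup>2 + \<kappa> * \<mu> * ((norm (v - u))\<^sup>2 + (norm (w - v))\<^sup>2)"
  proof -
    have "2 * l * (f u w - f u v - f v w)
        = 2 * (l * (f u w - f u v)) + 2 * (l * (f v s - f v w)) - 2 * l * f v s"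
      by (simp add: right_diff_distrib)
    moreover have "2 * l * (- \<gamma> * (norm (v - s))\<^sup>2) = - 2 * l * \<gamma> * (norm (v - s))\<^sup>2"
      by simp
    ultimately show ?thesis
      using 1 2 step \<open>2 * l * f v s \<le> _\<close> by linarith
  qed
  have 4: "2 * inner (b - w) (s - w) = (norm (w - b))\<^sup>2 + (norm (w - s))\<^sup>2 - (norm (b - s))\<^sup>2"
    using inner_diff_polarization[of b w s] by (simp add: norm_minus_commute)
  have 5: "2 * inner (b - v) (w - v) = (norm (b - v))\<^sup>2 + (norm (w - v))\<^sup>2 - (norm (w - b))\<^sup>2"
    using inner_diff_polarization[of b v w] by (simp add: norm_minus_commute)
  have "\<theta> * ?\<phi> * (norm (w - b))\<^sup>2 \<le> ?\<phi> * (norm (w - b))\<^sup>2"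
    using \<theta> golden_ratio_gt_1 by (intro mult_right_mono) auto
  moreover have "?\<phi>\<^sup>2 * (norm (b - s))\<^sup>2 = ?\<phi> * (norm (b - s))\<^sup>2 + (norm (b - s))\<^sup>2"
    by (simp add: power2_eq_square golden_ratio_square distrib_right)
  ultimately show ?thesis
    using 3 golden_average_norm[OF b', of s] unfolding 4 5 \<theta>_def[symmetric]
    by (simp add: algebra_simps)
qed

section \<open>Step sizes\<close>

lemma egra_step_size_le: "egra_step_size f \<mu> l u v w \<le> l"
  by (simp add: egra_step_size_def Let_def)

lemma egra_step_size_ge:
  assumes lip: "f u v + f v w \<ge> f u w - c1 * (norm (u - v))\<^sup>2 - c2 * (norm (v - w))\<^sup>2"
    and "0 < c1" "c1 \<le> c" "c2 \<le> c" "0 < \<mu>"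
  shows "min l (\<mu> / (2 * c)) \<le> egra_step_size f \<mu> l u v w"
proof (cases "f u w - f u v - f v w \<le> 0")
  case True
  then show ?thesis
    by (simp add: egra_step_size_def Let_def)
next
  case False
  define d N where "d = f u w - f u v - f v w" and "N = (norm (u - v))\<^sup>2 + (norm (v - w))\<^sup>2"
  have "0 < d"
    using False by (simp add: d_def)
  have "d \<le> c1 * (norm (u - v))\<^sup>2 + c2 * (norm (v - w))\<^sup>2"
    using lip by (simp add: d_def)
  also have "\<dots> \<le> c * (norm (u - v))\<^sup>2 + c * (norm (v - w))\<^sup>2"
    using assms by (intro add_mono mult_right_mono) auto
  finally have "d \<le> c * N"
    by (simp add: N_def distrib_left)
  then have "\<mu> * d \<le> \<mu> * (c * N)"
    using \<open>0 < \<mu>\<close> by simp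
  then have "\<mu> / (2 * c) \<le> \<mu> * N / (2 * d)"
    using \<open>0 < d\<close> assms by (simp add: divide_simps ac_simps)
  then show ?thesis
    using \<open>0 < d\<close> by (auto simp: egra_step_size_def Let_def d_def[symmetric] N_def[symmetric])
qed

text \<open>
  The rule bounds the defect of \<open>f\<close> in terms of the new step size \<open>l'\<close>, whereas the proximal step
  uses the old one; the factor \<open>l / l'\<close> converts between them.
\<close>
lemma egra_step_size_bound:
  assumes l': "l' = egra_step_size f \<mu> l u v w" "0 < l'" "0 < l" and "0 < \<mu>"
  shows "2 * l * (f u w - f u v - f v w)
    \<le> l / l' * \<mu> * ((norm (v - u))\<^sup>2 + (norm (w - v))\<^sup>2)"
proof -
  define d N where "d = f u w - f u v - f v w" and "N = (norm (u - v))\<^sup>2 + (norm (v - w))\<^sup>2"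
  have "2 * l' * d \<le> \<mu> * N"
  proof (cases "d \<le> 0")
    case True
    then have "2 * l' * d \<le> 0"
      using l'(2) by (simp add: mult_nonneg_nonpos)
    also have "0 \<le> \<mu> * N"
      using \<open>0 < \<mu>\<close> by (simp add: N_def)
    finally show ?thesis .
  next
    case False
    then have "l' \<le> \<mu> * N / (2 * d)"
      using l'(1) by (simp add: egra_step_size_def Let_def d_def[symmetric] N_def[symmetric])
    then show ?thesis
      using False by (simp add: field_simps)
  qed
  then have "l / l' * (2 * l' * d) \<le> l / l' * (\<mu> * N)"
    using l' by (intro mult_left_mono) auto
  moreover have "l / l' * (2 * l' * d) = 2 * l * d"
    using l'(2) by simp
  ultimately show ?thesis
    by (simp only: d_def N_def norm_minus_commute mult.assoc)
qed

text \<open>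
  Positivity of the step sizes and membership in \<open>C\<close> have to be shown together: a proximal point
  exists only for a positive step size, and the Lipschitz-type condition, which keeps the step sizes
  away from \<open>0\<close>, holds only for points of \<open>C\<close>.
\<close>
lemma egra_invariant:
  fixes C :: "'a::euclidean_space set"
  assumes C: "C \<noteq> {}" "closed C"
    and conv: "\<And>u. u \<in> C \<Longrightarrow> convex_on C (f u)"
    and lsc: "\<And>u. u \<in> C \<Longrightarrow> lower_semicontinuous_on C (f u)"
    and "lipschitz_type_on C f" "0 < \<mu>" "0 < lam 0" "x (-1) \<in> C" "x 0 \<in> C"
    and egra: "egra C f \<mu> xbar x lam"
  obtains m where "0 < m" "\<And>n. m \<le> lam (int n)" "\<And>n. x (int n - 1) \<in> C"
proof -
  obtain c1 c2 where c: "0 < c1" "0 < c2"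
    and lip: "\<And>x y z. x \<in> C \<Longrightarrow> y \<in> C \<Longrightarrow> z \<in> C \<Longrightarrow>
        f x y + f y z \<ge> f x z - c1 * (norm (x - y))\<^sup>2 - c2 * (norm (y - z))\<^sup>2"
    using assms(5) unfolding lipschitz_type_on_def by blast
  define m where "m = min (lam 0) (\<mu> / (2 * max c1 c2))"
  have "0 < m"
    using c assms by (auto simp: m_def)
  have "m \<le> lam (int n) \<and> x (int n - 1) \<in> C \<and> x (int n) \<in> C" for n
  proof (induction n)
    case 0
    then show ?case
      using assms by (simp add: m_def)
  next
    case (Suc n)
    have "x (int n + 1) = prox C (lam (int n)) (f (x (int n))) (xbar (int n))"
      using egra by (simp add: egra_def)
    moreover have "0 < lam (int n)"
      using Suc \<open>0 < m\<close> by simp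
    ultimately have x: "x (int n + 1) \<in> C"
      using Suc C conv lsc by (simp add: prox_in)
    have "min (lam (int n)) (\<mu> / (2 * max c1 c2))
        \<le> egra_step_size f \<mu> (lam (int n)) (x (int n - 1)) (x (int n)) (x (int n + 1))"
      using Suc c assms(6) x by (intro egra_step_size_ge[where ?c1.0 = c1 and ?c2.0 = c2] lip) auto
    then have "min (lam (int n)) (\<mu> / (2 * max c1 c2)) \<le> lam (int n + 1)"
      using egra by (simp add: egra_def)
    then show ?case
      using Suc x by (auto simp: m_def add.commute)
  qed
  then show thesis
    using that \<open>0 < m\<close> by blast
qed

section \<open>Linear rates\<close>

lemma eventually_contracting_imp_geometric:
  fixes V :: "nat \<Rightarrow> real"
  assumes "\<forall>\<^sub>F n in sequentially. V (Suc n) \<le> q * V n" "0 < q"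
  obtains K where "0 < K" "\<forall>\<^sub>F n in sequentially. V n \<le> K * q ^ n"
proof -
  obtain N where N: "\<And>n. N \<le> n \<Longrightarrow> V (Suc n) \<le> q * V n"
    using assms(1) unfolding eventually_sequentially by blast
  define K where "K = max 1 (V N / q ^ N)"
  have "V n \<le> K * q ^ n" if "N \<le> n" for n
    using that
  proof (induction n rule: dec_induct)
    case base
    then show ?case
      using \<open>0 < q\<close> by (simp add: K_def pos_divide_le_eq[symmetric])
  next
    case (step n)
    have "V (Suc n) \<le> q * V n"
      using N step by simp
    also have "\<dots> \<le> q * (K * q ^ n)"
      using step \<open>0 < q\<close> by simp
    finally show ?case
      by (simp add: ac_simps)
  qed
  then show thesis
    by (intro that[of K]) (auto simp: K_def eventually_sequentially)
qed

lemma geometric_bound_imp_R_linear: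
  fixes y :: "nat \<Rightarrow> 'a::real_normed_vector"
  assumes ev: "\<forall>\<^sub>F n in sequentially. (norm (y n - l))\<^sup>2 \<le> K * q ^ n"
    and "0 < K" "0 < q" "q < 1"
  shows "y \<longlonglongrightarrow> l \<and> limsup (\<lambda>n. ereal (root n (norm (y n - l)))) < 1"
proof
  have bound: "\<forall>\<^sub>F n in sequentially. norm (y n - l) \<le> sqrt K * sqrt q ^ n"
    using ev by eventually_elim (use assms in \<open>simp add: real_le_rsqrt real_sqrt_mult[symmetric] real_sqrt_power[symmetric]\<close>)
  have "(\<lambda>n. sqrt K * sqrt q ^ n) \<longlonglongrightarrow> sqrt K * 0"
    using assms by (intro tendsto_intros LIMSEQ_power_zero) auto
  then have "(\<lambda>n. y n - l) \<longlonglongrightarrow> 0"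
    using bound by (intro Lim_null_comparison[of "\<lambda>n. y n - l"]) auto
  then show "y \<longlonglongrightarrow> l"
    by (simp add: LIM_zero_iff)
  have "limsup (\<lambda>n. ereal (root n (norm (y n - l)))) \<le> limsup (\<lambda>n. ereal (root n (sqrt K) * sqrt q))"
  proof (rule Limsup_mono)
    show "\<forall>\<^sub>F n in sequentially. ereal (root n (norm (y n - l))) \<le> ereal (root n (sqrt K) * sqrt q)"
      using bound eventually_gt_at_top[of 0]
    proof eventually_elim
      case (elim n)
      then have "root n (norm (y n - l)) \<le> root n (sqrt K * sqrt q ^ n)"
        by simp
      also have "\<dots> = root n (sqrt K) * sqrt q"
        using elim \<open>0 < q\<close> by (simp add: real_root_mult real_root_power_cancel)
      finally show ?case
        by simp
    qed
  qed
  also have "(\<lambda>n. root n (sqrt K) * sqrt q) \<longlonglongrightarrow> 1 * sqrt q"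
    using \<open>0 < K\<close> by (intro tendsto_intros LIMSEQ_root_const) auto
  then have "limsup (\<lambda>n. ereal (root n (sqrt K) * sqrt q)) = ereal (sqrt q)"
    by (intro lim_imp_Limsup) auto
  also have "\<dots> < 1"
    using \<open>q < 1\<close> by simp
  finally show "limsup (\<lambda>n. ereal (root n (norm (y n - l)))) < 1" .
qed

text \<open>
  Since \<open>\<mu> < \<phi> / 2\<close>, there is room for constants \<open>\<mu> < B < \<phi> / 2 < A < \<phi> - \<mu>\<close>. As \<open>\<theta>\<close> and \<open>\<kappa>\<close>
  tend to \<open>1\<close>, the coefficients of \<open>d\<close> are eventually at least \<open>A\<close> on the left and at most \<open>B\<close> on
  the right, so the \<open>d\<close>-part of \<open>V = \<phi>\<^sup>2 a + A d\<close> shrinks by the factor \<open>B / A\<close>. The \<open>a\<close>-part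
  shrinks because \<open>e\<close> and \<open>g\<close> together control \<open>a\<close>.
\<close>
lemma energy_recursion_imp_geometric:
  fixes a d e g \<theta> \<kappa> :: "nat \<Rightarrow> real"
  assumes energy: "\<And>n. \<phi>\<^sup>2 * a (Suc n) + (\<phi> * \<theta> n - \<kappa> n * \<mu>) * d (Suc n) + c * e n + \<phi> * \<theta> n * g n
                        \<le> \<phi>\<^sup>2 * a n + \<kappa> n * \<mu> * d n"
    and \<theta>: "\<theta> \<longlonglongrightarrow> 1" and \<kappa>: "\<kappa> \<longlonglongrightarrow> 1"
    and "0 < \<mu>" "\<mu> < \<phi> / 2" "0 < c"
    and a_le: "\<And>n. a n \<le> 2 * e n + 2 * g n"
    and nonneg: "\<And>n. 0 \<le> a n" "\<And>n. 0 \<le> d n" "\<And>n. 0 \<le> e n" "\<And>n. 0 \<le> g n"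
  obtains K q where "0 < K" "0 < q" "q < 1" "\<forall>\<^sub>F n in sequentially. e n \<le> K * q ^ n"
proof -
  define B A where "B = (\<mu> + \<phi> / 2) / 2" and "A = \<phi> - B"
  have AB: "\<mu> < B" "0 < B" "B < A" "A < \<phi> * 1 - 1 * \<mu>" "0 < \<phi>"
    using \<open>0 < \<mu>\<close> \<open>\<mu> < \<phi> / 2\<close> by (auto simp: A_def B_def field_simps)
  define \<beta> where "\<beta> = min c (\<phi> / 2)"
  have \<beta>: "0 < \<beta>" "\<beta> \<le> c" "\<beta> \<le> \<phi> / 2"
    using assms AB by (auto simp: \<beta>_def)
  define q where "q = max (1 - \<beta> / (2 * \<phi>\<^sup>2)) (B / A)"
  have q: "0 < q" "q < 1"
    using AB \<beta> by (auto simp: q_def less_max_iff_disj)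
  define V where "V n = \<phi>\<^sup>2 * a n + A * d n" for n
  have "(\<lambda>n. \<kappa> n * \<mu>) \<longlonglongrightarrow> 1 * \<mu>" "(\<lambda>n. \<phi> * \<theta> n - \<kappa> n * \<mu>) \<longlonglongrightarrow> \<phi> * 1 - 1 * \<mu>"
    by (intro tendsto_intros \<theta> \<kappa>)+
  then have "\<forall>\<^sub>F n in sequentially. \<kappa> n * \<mu> < B"
    "\<forall>\<^sub>F n in sequentially. A < \<phi> * \<theta> n - \<kappa> n * \<mu>"
    using AB by (auto elim: order_tendstoD)
  moreover have "\<forall>\<^sub>F n in sequentially. 1 / 2 < \<theta> n"
    by (rule order_tendstoD(1)[OF \<theta>]) simp
  ultimately have main: "\<forall>\<^sub>F n in sequentially.
      V (Suc n) + \<beta> * e n + \<beta> * g n \<le> \<phi>\<^sup>2 * a n + B * d n"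
  proof eventually_elim
    case (elim n)
    have "A * d (Suc n) \<le> (\<phi> * \<theta> n - \<kappa> n * \<mu>) * d (Suc n)"
      using elim nonneg by (intro mult_right_mono) auto
    moreover have "\<kappa> n * \<mu> * d n \<le> B * d n"
      using elim nonneg by (intro mult_right_mono) auto
    moreover have "\<beta> * e n \<le> c * e n"
      using \<beta> nonneg by (intro mult_right_mono) auto
    moreover have "\<phi> * (1 / 2) \<le> \<phi> * \<theta> n"
      using elim AB by (intro mult_left_mono) auto
    then have "\<beta> \<le> \<phi> * \<theta> n"
      using \<beta>(3) by linarith
    then have "\<beta> * g n \<le> \<phi> * \<theta> n * g n"
      using nonneg by (intro mult_right_mono) auto
    ultimately show ?case
      using energy[of n] by (simp add: V_def)
  qed
  then have "\<forall>\<^sub>F n in sequentially. V (Suc n) \<le> q * V n"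
  proof eventually_elim
    case (elim n)
    have "\<beta> / 2 * a n \<le> \<beta> / 2 * (2 * e n + 2 * g n)"
      using \<beta> a_le by (intro mult_left_mono) auto
    have "V (Suc n) \<le> (1 - \<beta> / (2 * \<phi>\<^sup>2)) * (\<phi>\<^sup>2 * a n) + B / A * (A * d n)"
    proof -
      have "(1 - \<beta> / (2 * \<phi>\<^sup>2)) * (\<phi>\<^sup>2 * a n) = \<phi>\<^sup>2 * a n - \<beta> / 2 * a n"
        using AB by (simp add: left_diff_distrib)
      moreover have "B / A * (A * d n) = B * d n"
        using AB by simp
      ultimately show ?thesis
        using elim \<open>\<beta> / 2 * a n \<le> _\<close> by (simp add: distrib_left)
    qed
    also have "\<dots> \<le> q * (\<phi>\<^sup>2 * a n) + q * (A * d n)"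
      using nonneg AB by (intro add_mono mult_right_mono) (auto simp: q_def)
    finally show ?case
      by (simp add: V_def algebra_simps)
  qed
  then obtain K where K: "0 < K" "\<forall>\<^sub>F n in sequentially. V n \<le> K * q ^ n"
    using eventually_contracting_imp_geometric q(1) by metis
  have "\<forall>\<^sub>F n in sequentially. e n \<le> K / \<beta> * q ^ n"
    using main K(2)
  proof eventually_elim
    case (elim n)
    have "0 \<le> V (Suc n)" "0 \<le> \<beta> * g n" "B * d n \<le> A * d n"
      using nonneg AB \<beta> by (auto simp: V_def intro!: mult_right_mono)
    then have "\<beta> * e n \<le> K * q ^ n"
      using elim by (simp add: V_def)
    then show ?case
      using \<beta> by (simp add: field_simps)
  qed
  then show thesis
    using that[of "K / \<beta>" q] K(1) q \<beta> by simp
qed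

section \<open>Convergence of the golden ratio algorithm\<close>

theorem theorem2:
  fixes C :: "(real ^ 'm) set"
    and f :: "real ^ 'm \<Rightarrow> real ^ 'm \<Rightarrow> real"
    and xdag :: "real ^ 'm"
    and xbar x :: "int \<Rightarrow> real ^ 'm"
    and lam :: "int \<Rightarrow> real"
    and \<mu> :: real
  assumes "C \<noteq> {}" and "closed C" and "convex C"
    and "\<And>u. u \<in> C \<Longrightarrow> f u u = 0"
    and "strongly_pseudomonotone_on C f"
    and "lipschitz_type_on C f"
    and "\<And>u. u \<in> C \<Longrightarrow> convex_on C (f u)"
    and "\<And>u. u \<in> C \<Longrightarrow> lower_semicontinuous_on C (f u)"
    and "\<And>v. v \<in> C \<Longrightarrow> hemicontinuous_on C (\<lambda>u. f u v)"
    and "equilibrium_solution C f xdag"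
    and "0 < \<mu>" and "\<mu> < golden_ratio / 2"
    and "0 < lam 0"
    and "x (-1) \<in> C" and "x 0 \<in> C"
    and "egra C f \<mu> xbar x lam"
  shows "(\<lambda>n::nat. x (int n)) \<longlonglongrightarrow> xdag \<and>
         limsup (\<lambda>n::nat. ereal (root n (norm (x (int n) - xdag)))) < 1"
proof -
  let ?\<phi> = "golden_ratio"
  have xdag: "xdag \<in> C" "\<And>y. y \<in> C \<Longrightarrow> 0 \<le> f xdag y"
    using assms(10) by (auto simp: equilibrium_solution_def)
  obtain \<gamma> where \<gamma>: "0 < \<gamma>"
    "\<And>x y. x \<in> C \<Longrightarrow> y \<in> C \<Longrightarrow> f x y \<ge> 0 \<Longrightarrow> f y x \<le> - \<gamma> * (norm (x - y))\<^sup>2"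
    using assms(5) unfolding strongly_pseudomonotone_on_def by blast
  have mono: "f y xdag \<le> - \<gamma> * (norm (y - xdag))\<^sup>2" if "y \<in> C" for y
    using \<gamma>(2)[OF xdag(1) that] xdag(2)[OF that] by (simp add: norm_minus_commute)
  obtain m where m: "0 < m" "\<And>n. m \<le> lam (int n)" "\<And>n. x (int n - 1) \<in> C"
    using egra_invariant[OF assms(1,2,7,8,6,11,13-16)] by blast
  have xC: "x (int n) \<in> C" for n
    using m(3)[of "Suc n"] by simp
  have pos: "0 < lam (int n)" for n
    using m(1,2) by (rule less_le_trans)
  have egra: "xbar (int n) = ((?\<phi> - 1) *\<^sub>R x (int n) + xbar (int n - 1)) /\<^sub>R ?\<phi>"
    "x (int (Suc n)) = prox C (lam (int n)) (f (x (int n))) (xbar (int n))"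
    "lam (int (Suc n)) = egra_step_size f \<mu> (lam (int n)) (x (int n - 1)) (x (int n)) (x (int (Suc n)))"
    for n
    using assms(16) by (simp_all add: egra_def add.commute[of 1])
  have dec: "lam (int (Suc n)) \<le> lam (int n)" for n
    unfolding egra(3) by (rule egra_step_size_le)
  then have "decseq (\<lambda>n. lam (int n))"
    by (simp add: decseq_Suc_iff)
  then obtain L where L: "(\<lambda>n. lam (int n)) \<longlonglongrightarrow> L"
    using decseq_convergent m(2) by blast
  have "m \<le> L"
    using LIMSEQ_le_const[OF L] m(2) by blast
  then have "L \<noteq> 0"
    using m(1) by simp
  define \<theta> \<kappa> where "\<theta> n = lam (int (Suc n)) / lam (int n)"
    and "\<kappa> n = lam (int (Suc n)) / lam (int (Suc (Suc n)))" for n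
  have L1: "(\<lambda>n. lam (int (Suc n))) \<longlonglongrightarrow> L" and L2: "(\<lambda>n. lam (int (Suc (Suc n)))) \<longlonglongrightarrow> L"
    using LIMSEQ_Suc[OF L] LIMSEQ_Suc[OF LIMSEQ_Suc[OF L]] by blast+
  have "\<theta> \<longlonglongrightarrow> L / L" "\<kappa> \<longlonglongrightarrow> L / L"
    unfolding \<theta>_def \<kappa>_def by (intro tendsto_divide L L1 L2 \<open>L \<noteq> 0\<close>)+
  then have lims: "\<theta> \<longlonglongrightarrow> 1" "\<kappa> \<longlonglongrightarrow> 1"
    using \<open>L \<noteq> 0\<close> by simp_all

  \<comment> \<open>The quantities are shifted by one, because the energy inequality involves the step before
    the current one, which is a proximal step only from index \<open>1\<close> on.\<close>
  define a d e g where "a n = (norm (xbar (int (Suc n)) - xdag))\<^sup>2"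
    and "d n = (norm (x (int (Suc n)) - x (int n)))\<^sup>2"
    and "e n = (norm (x (int (Suc n)) - xdag))\<^sup>2"
    and "g n = (norm (xbar (int (Suc n)) - x (int (Suc n))))\<^sup>2" for n
  have energy: "?\<phi>\<^sup>2 * a (Suc n) + (?\<phi> * \<theta> n - \<kappa> n * \<mu>) * d (Suc n) + (2 * m * \<gamma>) * e n
      + ?\<phi> * \<theta> n * g n \<le> ?\<phi>\<^sup>2 * a n + \<kappa> n * \<mu> * d n" for n
  proof -
    have "2 * m * \<gamma> * e n \<le> 2 * lam (int (Suc n)) * \<gamma> * e n"
      using m(2)[of "Suc n"] \<gamma>(1) by (intro mult_right_mono) (auto simp: e_def)
    moreover have "?\<phi>\<^sup>2 * a (Suc n) + (?\<phi> * \<theta> n - \<kappa> n * \<mu>) * d (Suc n)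
        + 2 * lam (int (Suc n)) * \<gamma> * e n + ?\<phi> * \<theta> n * g n \<le> ?\<phi>\<^sup>2 * a n + \<kappa> n * \<mu> * d n"
      unfolding a_def d_def e_def g_def \<theta>_def
    proof (rule egra_energy_inequality[OF assms(1,2,7,8) xC xC xdag(1) pos pos dec egra(2) egra(2)
          _ _ mono[OF xC]])
      show "xbar (int (Suc n)) = ((?\<phi> - 1) *\<^sub>R x (int (Suc n)) + xbar (int n)) /\<^sub>R ?\<phi>"
        using egra(1)[of "Suc n"] by simp
      show "xbar (int (Suc (Suc n)))
          = ((?\<phi> - 1) *\<^sub>R x (int (Suc (Suc n))) + xbar (int (Suc n))) /\<^sub>R ?\<phi>"
        using egra(1)[of "Suc (Suc n)"] by simp
      have "lam (int (Suc (Suc n))) = egra_step_size f \<mu> (lam (int (Suc n)))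
          (x (int n)) (x (int (Suc n))) (x (int (Suc (Suc n))))"
        using egra(3)[of "Suc n"] by simp
      then show "2 * lam (int (Suc n)) * (f (x (int n)) (x (int (Suc (Suc n))))
          - f (x (int n)) (x (int (Suc n))) - f (x (int (Suc n))) (x (int (Suc (Suc n)))))
        \<le> \<kappa> n * \<mu> * ((norm (x (int (Suc n)) - x (int n)))\<^sup>2
          + (norm (x (int (Suc (Suc n))) - x (int (Suc n))))\<^sup>2)"
        unfolding \<kappa>_def by (rule egra_step_size_bound[OF _ pos pos assms(11)])
    qed
    ultimately show ?thesis
      by linarith
  qed
  have a_le: "a n \<le> 2 * e n + 2 * g n" for n
  proof -
    let ?u = "x (int (Suc n)) - xdag" and ?v = "xbar (int (Suc n)) - x (int (Suc n))"
    have "a n = (norm (?u + ?v))\<^sup>2"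
      by (simp add: a_def)
    also have "\<dots> \<le> (norm ?u + norm ?v)\<^sup>2"
      by (intro power_mono norm_triangle_ineq) auto
    also have "\<dots> \<le> 2 * (norm ?u)\<^sup>2 + 2 * (norm ?v)\<^sup>2"
      using sum_squares_bound[of "norm ?u" "norm ?v"] by (simp add: power2_sum)
    finally show ?thesis
      by (simp add: e_def g_def)
  qed
  have "0 < 2 * m * \<gamma>"
    using m(1) \<gamma>(1) by simp
  then obtain K q where Kq: "0 < K" "0 < q" "q < 1" "\<forall>\<^sub>F n in sequentially. e n \<le> K * q ^ n"
    using energy_recursion_imp_geometric[OF energy lims assms(11,12) _ a_le]
    by (auto simp: a_def d_def e_def g_def)
  have "\<forall>\<^sub>F n in sequentially. (norm (x (int (Suc n)) - xdag))\<^sup>2 \<le> K / q * q ^ Suc n"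
    using Kq(4) by eventually_elim (use Kq in \<open>simp add: e_def\<close>)
  then have "\<forall>\<^sub>F n in sequentially. (norm (x (int n) - xdag))\<^sup>2 \<le> K / q * q ^ n"
    by (subst (asm) eventually_sequentially_Suc)
  then show ?thesis
    using Kq by (intro geometric_bound_imp_R_linear[where K = "K / q" and q = q]) auto
qed

end
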